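(* Let $d\geq 1$ and let $\mu$ be a finite Borel measure with compact support on $\mathbb{R}^d$. Then for all $\theta\in[0,1]$, $$\dim^\theta_{\mathrm{F}}\mu \leq \dim_{\mathrm{F}}\mu + d\theta .$$
   Context: Measures are non-negative. The Fourier transform of a finite Borel measure $\mu$ on $\mathbb{R}^d$ is $\widehat{\mu}(z)=\int e^{-2\pi i z\cdot x}\,d\mu(x)$, $z\in\mathbb{R}^d$. For $s\geq 0$, the $(s,\theta)$-energies are $$\mathcal{J}_{s,\theta}(\mu)=\bigg(\int_{\mathbb{R}^d}|\widehat{\mu}(z)|^{\frac{2}{\theta}}|z|^{\frac{s}{\theta}-d}\,dz\bigg)^{\theta}\quad(\theta\in(0,1]),\qquad \mathcal{J}_{s,0}(\mu)=\sup_{z\in\mathbb{R}^d}|\widehat{\mu}(z)|^2|z|^s .$$ The Fourier spectrum of $\mu$ at $\theta\in[0,1]$ is $\dim^\theta_{\mathrm{F}}\mu=\sup\{s\geq 0:\mathcal{J}_{s,\theta}(\mu)<\infty\}\in[0,\infty]$, with the supremum of the empty set taken to be $0$. The Fourier dimension of $\mu$ is $\dim_{\mathrm{F}}\mu=\sup\{s\geq 0: |\widehat{\mu}(z)|\lesssim |z|^{-s/2}\}\in[0,\infty]$, where $|\widehat{\mu}(z)|\lesssim |z|^{-s/2}$ means that there is a constant $c>0$ with $|\widehat{\mu}(z)|\leq c|z|^{-s/2}$ for all $z\in\mathbb{R}^d\setminus\{0\}$. *)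

theory Defs
  imports "HOL-Analysis.Analysis"
begin

text \<open>
  The ambient space is a type of class \<open>euclidean_space\<close>, of dimension
  \<open>d = DIM('a) \<ge> 1\<close>; this covers \<open>real ^ 'n\<close> for every finite \<open>'n\<close>.
\<close>

definition msupport :: "'a::topological_space measure \<Rightarrow> 'a set" where
  "msupport \<mu> = {x. \<forall>U. open U \<and> x \<in> U \<longrightarrow> emeasure \<mu> U > 0}"

definition fourier_transform :: "'a::euclidean_space measure \<Rightarrow> 'a \<Rightarrow> complex" where
  "fourier_transform \<mu> z =
     (LINT x|\<mu>. exp (- 2 * complex_of_real pi * \<i> * complex_of_real (z \<bullet> x)))"

text \<open>Real powers of extended nonnegative numbers, for exponents \<open>a > 0\<close>.\<close>

definition ennreal_powr :: "ennreal \<Rightarrow> real \<Rightarrow> ennreal" where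
  "ennreal_powr x a = (if x = \<infinity> then \<infinity> else ennreal (enn2real x powr a))"

text \<open>
  In the case \<open>\<theta> = 0\<close> the conditional encodes the convention \<open>0\<^sup>0 = 1\<close> for
  \<open>s = 0\<close>, \<open>z = 0\<close>, since \<open>0 powr 0 = 0\<close>. In the case \<open>\<theta> > 0\<close> the value of the
  integrand at the single point \<open>z = 0\<close> is irrelevant.
\<close>

definition fourier_energy :: "real \<Rightarrow> real \<Rightarrow> 'a::euclidean_space measure \<Rightarrow> ennreal" where
  "fourier_energy s \<theta> \<mu> =
     (if \<theta> = 0
      then (SUP z. ennreal ((norm (fourier_transform \<mu> z))\<^sup>2 * (if s = 0 then 1 else norm z powr s)))
      else ennreal_powr
        (\<integral>\<^sup>+ z. ennreal (norm (fourier_transform \<mu> z) powr (2 / \<theta>)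
                    * norm z powr (s / \<theta> - real DIM('a))) \<partial>lborel) \<theta>)"

text \<open>Suprema are taken in \<open>ennreal\<close>, where \<open>Sup {} = 0\<close>.\<close>

definition fourier_spectrum :: "real \<Rightarrow> 'a::euclidean_space measure \<Rightarrow> ennreal" where
  "fourier_spectrum \<theta> \<mu> = Sup (ennreal ` {s. 0 \<le> s \<and> fourier_energy s \<theta> \<mu> < \<infinity>})"

definition fourier_dim :: "'a::euclidean_space measure \<Rightarrow> ennreal" where
  "fourier_dim \<mu> = Sup (ennreal ` {s. 0 \<le> s \<and>
     (\<exists>c>0. \<forall>z. z \<noteq> 0 \<longrightarrow> norm (fourier_transform \<mu> z) \<le> c * norm z powr (- s / 2))})"

end

theory Submission
  imports Defs
begin

text \<open>
  For \<open>\<theta> > 0\<close> the heart of the matter is a pointwise bound from an integral bound. Write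
  \<open>f\<close> for the Fourier transform of \<open>\<mu>\<close>, and put \<open>p = 2 / \<theta>\<close> and
  \<open>b = s / \<theta> - d\<close>, so that finiteness of the energy says that \<open>|f|\<^sup>p |z|\<^sup>b\<close> is
  integrable. Since \<open>\<mu>\<close> has compact support, \<open>f\<close> is roughly constant at unit
  scale, and one expects \<open>|f(z)|\<^sup>p |z|\<^sup>b\<close> to be bounded, that is,
  \<open>f(z) = O(|z| powr (- b / p))\<close>. As \<open>b / p = (s - d \<theta>) / 2\<close>, this is the inequality.

  "Roughly constant" is made precise by averaging. Let \<open>A\<close> be the average over
  balls of radius \<open>\<delta>\<close>. For an average the expected decay does hold, by an
  elementary substitute for Jensen's inequality (\<open>ball_average_decay\<close>). On the other
  side of the Fourier transform, \<open>A\<close> multiplies \<open>\<mu>\<close> by the transform \<open>m\<close> of the uniform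
  distribution on the ball, and \<open>|1 - m| \<le> \<eta>\<close> on the support of \<open>\<mu>\<close>, where \<open>\<eta>\<close> is as small as
  desired if \<open>\<delta>\<close> is small. A single replacement of \<open>f\<close> by \<open>A f\<close> has an error that is
  small but does not decay. Integrating the geometric sum
  \<open>1 = (1 - m)\<^sup>N + (\<Sum>k<N. (1 - m)\<^sup>k m)\<close> against \<open>\<mu>\<close> improves this to
  \<open>|f(z)| \<le> \<eta>\<^sup>N \<mu>(UNIV) + 2\<^sup>N B\<close>, where \<open>B\<close> bounds \<open>|A f|\<close> within distance
  \<open>N \<delta>\<close> of \<open>z\<close> (\<open>norm_fourier_transform_le_averages\<close>).

  With \<open>N\<close> close to \<open>\<kappa> log\<^sub>2 |z|\<close>, the factor \<open>2\<^sup>N\<close> costs only \<open>|z| powr \<kappa>\<close>, while \<open>\<eta>\<^sup>N\<close>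
  decays as fast as desired once \<open>\<eta>\<close> is small in terms of \<open>\<kappa>\<close>. So
  every exponent below \<open>b / p\<close> is attained (\<open>fourier_transform_decay\<close>), which is
  enough, because the Fourier dimension is a supremum. For
  \<open>\<theta> = 0\<close> the finite energy is itself the required decay.
\<close>

section \<open>Characters and the uniform distribution on a ball\<close>

definition wave :: "'a::euclidean_space \<Rightarrow> 'a \<Rightarrow> complex" where
  "wave z x = cis (- 2 * pi * (z \<bullet> x))"

definition weighted_fourier :: "'a::euclidean_space measure \<Rightarrow> ('a \<Rightarrow> complex) \<Rightarrow> 'a \<Rightarrow> complex" where
  "weighted_fourier \<mu> g z = (LINT x|\<mu>. g x * wave z x)"

definition unif_ball :: "real \<Rightarrow> 'a::euclidean_space measure" where
  "unif_ball \<delta> = uniform_measure lborel (ball 0 \<delta>)"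

lemma norm_wave [simp]: "norm (wave z x) = 1"
  by (simp add: wave_def)

lemma wave_commute: "wave z x = wave x z"
  by (simp add: wave_def inner_commute)

lemma wave_add: "wave (z + u) x = wave z x * wave u x"
  by (simp add: wave_def cis_mult algebra_simps inner_add_left)

lemma wave_measurable [measurable]:
  assumes [measurable]: "f \<in> borel_measurable M" "g \<in> borel_measurable M"
  shows "(\<lambda>x. wave (f x) (g x)) \<in> borel_measurable M"
  unfolding wave_def cis_conv_exp by measurable

lemma fourier_transform_eq_wave: "fourier_transform \<mu> z = (LINT x|\<mu>. wave z x)"
  unfolding fourier_transform_def wave_def cis_conv_exp
  by (rule Bochner_Integration.integral_cong) (auto simp: algebra_simps)

lemma fourier_transform_eq_weighted: "fourier_transform \<mu> = weighted_fourier \<mu> (\<lambda>_. 1)"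
  by (rule ext) (simp add: fourier_transform_eq_wave weighted_fourier_def)

lemma norm_one_minus_cis_le: "norm (1 - cis t) \<le> \<bar>t\<bar>"
proof -
  have "norm (1 - cis t) = 2 * \<bar>sin (t / 2)\<bar>"
    using dist_exp_i_1[of t] by (simp add: cis_conv_exp norm_minus_commute)
  also have "\<dots> \<le> \<bar>t\<bar>"
    using abs_sin_x_le_abs_x[of "t/2"] by simp
  finally show ?thesis .
qed

lemma unif_ball_sets [simp, measurable_cong]: "sets (unif_ball \<delta>) = sets borel"
  by (simp add: unif_ball_def)

lemma unif_ball_mass:
  assumes "\<delta> > 0"
  shows "emeasure (unif_ball \<delta> :: 'a::euclidean_space measure) (space (unif_ball \<delta>)) = 1"
proof -
  have "emeasure lborel (ball (0::'a) \<delta>) \<noteq> 0"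
    using content_ball_pos[OF assms, of "0::'a"] by (auto simp: measure_def)
  moreover have "emeasure lborel (ball (0::'a) \<delta>) \<noteq> \<infinity>"
    using emeasure_lborel_ball_finite[of "0::'a" \<delta>] by auto
  ultimately show ?thesis
    by (simp add: unif_ball_def ennreal_divide_self less_top)
qed

lemma unif_ball_finite: "\<delta> > 0 \<Longrightarrow> finite_measure (unif_ball \<delta>)"
  by (intro finite_measureI) (simp add: unif_ball_mass)

lemma unif_ball_measure: "\<delta> > 0 \<Longrightarrow> measure (unif_ball \<delta>) (space (unif_ball \<delta>)) = 1"
  by (simp add: measure_def unif_ball_mass)

lemma unif_ball_AE: "AE u in unif_ball \<delta>. norm u < \<delta>"
  unfolding unif_ball_def by (rule AE_uniform_measureI) auto

lemma finite_measure_norm_integral_le: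
  fixes f :: "'b \<Rightarrow> complex"
  assumes "finite_measure M" "AE x in M. norm (f x) \<le> B" "B \<ge> 0"
  shows "norm (LINT x|M. f x) \<le> B * measure M (space M)"
proof -
  interpret finite_measure M by fact
  have "norm (LINT x|M. f x) \<le> (LINT x|M. norm (f x))"
    by (rule integral_norm_bound)
  also have "\<dots> \<le> (LINT x|M. B)"
    using assms by (intro integral_mono_AE') auto
  finally show ?thesis by (simp add: mult.commute)
qed

text \<open>
  The transform of a probability measure on a ball of radius \<open>\<delta>\<close> is Lipschitz with constant
  \<open>2 \<pi> \<delta>\<close>, and its value at \<open>0\<close> is \<open>1\<close>. This is what makes the averaging operator close to the identity
  on measures with bounded support.
\<close>

lemma one_minus_unif_ball_transform_le:
  assumes "\<delta> > 0"
  shows "norm (1 - fourier_transform (unif_ball \<delta>) x) \<le> 2 * pi * \<delta> * norm x"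
proof -
  interpret finite_measure "unif_ball \<delta> :: 'a measure" by (rule unif_ball_finite[OF assms])
  have int: "integrable (unif_ball \<delta>) (wave x)"
    by (rule integrable_const_bound[where B=1]) auto
  have "1 - fourier_transform (unif_ball \<delta>) x = (LINT u|unif_ball \<delta>. 1 - wave x u)"
    using int unif_ball_measure[OF assms, where ?'a='a]
    by (simp add: fourier_transform_eq_wave)
  also have "norm \<dots> \<le> (2 * pi * \<delta> * norm x) * measure (unif_ball \<delta> :: 'a measure) (space (unif_ball \<delta>))"
  proof (rule finite_measure_norm_integral_le)
    show "AE u in unif_ball \<delta>. norm (1 - wave x u) \<le> 2 * pi * \<delta> * norm x"
      using unif_ball_AE[of \<delta>]
    proof eventually_elim
      case (elim u)
      have "norm (1 - wave x u) \<le> 2 * pi * \<bar>x \<bullet> u\<bar>"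
        unfolding wave_def by (rule order_trans[OF norm_one_minus_cis_le]) (simp add: abs_mult)
      also have "\<bar>x \<bullet> u\<bar> \<le> norm x * \<delta>"
        using Cauchy_Schwarz_ineq2[of x u] elim
        by (meson less_imp_le mult_left_mono norm_ge_zero order_trans)
      finally show ?case by (simp add: mult_ac)
    qed
  qed (use assms in \<open>auto intro: unif_ball_finite\<close>)
  finally show ?thesis using unif_ball_measure[OF assms, where ?'a='a] by simp
qed

lemma unif_ball_transform_measurable [measurable]:
  assumes "\<delta> > 0"
  shows "fourier_transform (unif_ball \<delta>) \<in> borel_measurable borel"
proof -
  interpret finite_measure "unif_ball \<delta> :: 'a measure" by (rule unif_ball_finite[OF assms])
  show ?thesis
    unfolding fourier_transform_eq_wave[abs_def]
    by (rule borel_measurable_lebesgue_integral) measurable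
qed

lemma norm_unif_ball_transform_le: 
  assumes "\<delta> > 0"
  shows "norm (fourier_transform (unif_ball \<delta>) x) \<le> 1"
  using finite_measure_norm_integral_le[OF unif_ball_finite[OF assms], of "wave x" 1]
    unif_ball_measure[OF assms, where ?'a='a]
  by (simp add: fourier_transform_eq_wave)

section \<open>Transforms of a measure with a bounded density\<close>

text \<open>
  The class of densities that is closed under all operations used below and for
  which Fubini's theorem and linearity hold against every finite measure.
\<close>

definition bounded_borel :: "('a::euclidean_space \<Rightarrow> complex) \<Rightarrow> bool" where
  "bounded_borel g \<longleftrightarrow> g \<in> borel_measurable borel \<and> (\<exists>B. \<forall>x. norm (g x) \<le> B)"

lemma bounded_borelI: "g \<in> borel_measurable borel \<Longrightarrow> (\<And>x. norm (g x) \<le> B) \<Longrightarrow> bounded_borel g"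
  unfolding bounded_borel_def by auto

lemma bounded_borelD [measurable_dest]: "bounded_borel g \<Longrightarrow> g \<in> borel_measurable borel"
  unfolding bounded_borel_def by auto

lemma bounded_borel_const: "bounded_borel (\<lambda>_. c)"
  by (rule bounded_borelI[where B="norm c"]) auto

lemma bounded_borel_mult:
  assumes "bounded_borel g" "bounded_borel h"
  shows "bounded_borel (\<lambda>x. g x * h x)"
proof -
  obtain B C where B: "\<And>x. norm (g x) \<le> B" and C: "\<And>x. norm (h x) \<le> C"
    using assms unfolding bounded_borel_def by auto
  have [measurable]: "g \<in> borel_measurable borel" "h \<in> borel_measurable borel"
    using assms by (auto simp: bounded_borel_def)
  have "norm (g x * h x) \<le> B * C" for x
    using B[of x] C[of x] unfolding norm_mult by (intro mult_mono') auto
  then show ?thesis by (intro bounded_borelI[where B="B*C"]) auto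
qed

lemma bounded_borel_diff:
  assumes "bounded_borel g" "bounded_borel h"
  shows "bounded_borel (\<lambda>x. g x - h x)"
proof -
  obtain B C where B: "\<And>x. norm (g x) \<le> B" and C: "\<And>x. norm (h x) \<le> C"
    using assms unfolding bounded_borel_def by auto
  have [measurable]: "g \<in> borel_measurable borel" "h \<in> borel_measurable borel"
    using assms by (auto simp: bounded_borel_def)
  have "norm (g x - h x) \<le> B + C" for x
    using B[of x] C[of x] norm_triangle_ineq4[of "g x" "h x"] by linarith
  then show ?thesis by (intro bounded_borelI[where B="B+C"]) auto
qed

lemma bounded_borel_power: "bounded_borel g \<Longrightarrow> bounded_borel (\<lambda>x. g x ^ k)"
  by (induction k) (auto intro: bounded_borel_const bounded_borel_mult)

lemma bounded_borel_unif_ball_transform: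
  "\<delta> > 0 \<Longrightarrow> bounded_borel (fourier_transform (unif_ball \<delta>))"
  by (rule bounded_borelI[where B=1])
     (auto intro: norm_unif_ball_transform_le unif_ball_transform_measurable)

context
  fixes \<mu> :: "'a::euclidean_space measure"
  assumes sets_mu [measurable_cong]: "sets \<mu> = sets borel"
    and finite_mu: "finite_measure \<mu>"
begin

interpretation finite_measure \<mu> by (rule finite_mu)

lemma integrable_wave:
  assumes "bounded_borel g"
  shows "integrable \<mu> (\<lambda>x. g x * wave z x)"
proof -
  obtain B where B: "\<And>x. norm (g x) \<le> B" 
    using assms unfolding bounded_borel_def by auto
  have [measurable]: "g \<in> borel_measurable borel" using assms by (rule bounded_borelD)
  show ?thesis
    by (rule integrable_const_bound[where B=B]) (auto simp: norm_mult B)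
qed

lemma weighted_fourier_diff:
  assumes "bounded_borel g" "bounded_borel h"
  shows "weighted_fourier \<mu> (\<lambda>x. g x - h x) z = weighted_fourier \<mu> g z - weighted_fourier \<mu> h z"
  unfolding weighted_fourier_def left_diff_distrib
  by (intro Bochner_Integration.integral_diff integrable_wave assms)

lemma weighted_fourier_measurable:
  assumes "bounded_borel g"
  shows "weighted_fourier \<mu> g \<in> borel_measurable borel"
proof -
  have [measurable]: "g \<in> borel_measurable borel" using assms by (rule bounded_borelD)
  show ?thesis
    unfolding weighted_fourier_def[abs_def]
    by (rule borel_measurable_lebesgue_integral) measurable
qed

text \<open>
  Averaging is convolution with the uniform distribution, so it acts on the density
  as a multiplier: this is Fubini's theorem, after splitting the character at \<open>z + u\<close>.
\<close>

lemma ball_average_weighted_fourier: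
  assumes "\<delta> > 0" and g: "bounded_borel g"
  shows "(LINT u|unif_ball \<delta>. weighted_fourier \<mu> g (z + u))
       = weighted_fourier \<mu> (\<lambda>x. fourier_transform (unif_ball \<delta>) x * g x) z"
proof -
  interpret U: finite_measure "unif_ball \<delta> :: 'a measure" by (rule unif_ball_finite[OF assms(1)])
  interpret P: pair_sigma_finite \<mu> "unif_ball \<delta> :: 'a measure" ..
  interpret PF: finite_measure "\<mu> \<Otimes>\<^sub>M (unif_ball \<delta> :: 'a measure)"
    by (rule finite_measure_pair_measure) (unfold_locales)
  obtain B where B: "\<And>x. norm (g x) \<le> B" 
    using g unfolding bounded_borel_def by auto
  have [measurable]: "g \<in> borel_measurable borel" using g by (rule bounded_borelD)
  have "integrable (\<mu> \<Otimes>\<^sub>M unif_ball \<delta>) (\<lambda>(x, u). g x * wave (z + u) x)"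
    by (rule PF.integrable_const_bound[where B=B]) (auto simp: norm_mult B)
  then have "(LINT u|unif_ball \<delta>. LINT x|\<mu>. g x * wave (z + u) x)
      = (LINT x|\<mu>. LINT u|unif_ball \<delta>. g x * wave (z + u) x)"
    by (rule P.Fubini_integral)
  also have "\<dots> = (LINT x|\<mu>. fourier_transform (unif_ball \<delta>) x * g x * wave z x)"
  proof (rule Bochner_Integration.integral_cong[OF refl])
    fix x
    have "g x * wave (z + u) x = (g x * wave z x) * wave x u" for u
      by (simp add: wave_add wave_commute[of u x])
    then have "(LINT u|unif_ball \<delta>. g x * wave (z + u) x) = (LINT u|unif_ball \<delta>. (g x * wave z x) * wave x u)"
      by (rule Bochner_Integration.integral_cong[OF refl])
    then show "(LINT u|unif_ball \<delta>. g x * wave (z + u) x)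
        = fourier_transform (unif_ball \<delta>) x * g x * wave z x"
      by (simp add: fourier_transform_eq_wave mult_ac)
  qed
  finally show ?thesis by (simp add: weighted_fourier_def)
qed

text \<open>
  Multiplying the density by \<open>1 - m\<close> replaces a transform \<open>F\<close> by \<open>F\<close> minus its average.
  Each such step at most doubles a bound on \<open>|F|\<close>, at the price of
  shrinking by \<open>\<delta>\<close> the ball on which the bound is known.
\<close>

lemma weighted_fourier_complement_power_le:
  fixes g :: "'a \<Rightarrow> complex"
  assumes \<delta>: "\<delta> > 0" and "bounded_borel g" and "B \<ge> 0"
    and "\<And>w. norm (w - z) \<le> real k * \<delta> \<Longrightarrow> norm (weighted_fourier \<mu> g w) \<le> B"
  shows "norm (weighted_fourier \<mu> (\<lambda>x. (1 - fourier_transform (unif_ball \<delta>) x) ^ k * g x) z) \<le> 2 ^ k * B"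
  using assms(2-)
proof (induction k arbitrary: g B)
  case 0
  then show ?case by simp
next
  case (Suc k)
  let ?m = "fourier_transform (unif_ball \<delta> :: 'a measure)"
  have m: "bounded_borel ?m" by (rule bounded_borel_unif_ball_transform[OF \<delta>])
  let ?h = "\<lambda>x. g x - ?m x * g x"
  have "norm (weighted_fourier \<mu> (\<lambda>x. (1 - ?m x) ^ k * ?h x) z) \<le> 2 ^ k * (2 * B)"
  proof (rule Suc.IH)
    show "bounded_borel ?h" using m Suc.prems by (intro bounded_borel_diff bounded_borel_mult)
    show "0 \<le> 2 * B" using Suc.prems by simp
    fix w :: 'a assume w: "norm (w - z) \<le> real k * \<delta>"
    have "norm (LINT u|unif_ball \<delta>. weighted_fourier \<mu> g (w + u)) \<le> B * measure (unif_ball \<delta> :: 'a measure) (space (unif_ball \<delta>))"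
    proof (rule finite_measure_norm_integral_le)
      show "AE u in unif_ball \<delta>. norm (weighted_fourier \<mu> g (w + u)) \<le> B"
        using unif_ball_AE[of \<delta>]
      proof eventually_elim
        case (elim u)
        have "norm ((w + u) - z) \<le> norm (w - z) + norm u"
          using norm_triangle_ineq[of "w - z" u] by (simp add: algebra_simps)
        with w elim have "norm ((w + u) - z) \<le> real (Suc k) * \<delta>"
          by (simp add: algebra_simps)
        then show ?case by (rule Suc.prems)
      qed
    qed (use \<delta> Suc.prems in \<open>auto intro: unif_ball_finite\<close>)
    then have 1: "norm (weighted_fourier \<mu> (\<lambda>x. ?m x * g x) w) \<le> B"
      using unif_ball_measure[OF \<delta>, where ?'a='a] Suc.prems 
      by (simp add: ball_average_weighted_fourier[OF \<delta>])
    have "real k * \<delta> \<le> real (Suc k) * \<delta>" using \<delta> by (simp add: algebra_simps)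
    with w have 2: "norm (weighted_fourier \<mu> g w) \<le> B" by (intro Suc.prems) linarith
    have "weighted_fourier \<mu> ?h w = weighted_fourier \<mu> g w - weighted_fourier \<mu> (\<lambda>x. ?m x * g x) w"
      using m Suc.prems by (intro weighted_fourier_diff bounded_borel_mult)
    with 1 2 norm_triangle_ineq4[of "weighted_fourier \<mu> g w" "weighted_fourier \<mu> (\<lambda>x. ?m x * g x) w"]
    show "norm (weighted_fourier \<mu> ?h w) \<le> 2 * B" by simp
  qed
  moreover have "(\<lambda>x. (1 - ?m x) ^ k * ?h x) = (\<lambda>x. (1 - ?m x) ^ Suc k * g x)"
    by (rule ext) (simp add: algebra_simps)
  ultimately show ?case by (simp add: mult_ac)
qed

text \<open>
  The geometric sum splits the transform into one term with density \<open>(1 - m)\<^sup>N\<close>, which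
  is uniformly small because \<open>|1 - m|\<close> is small on the support, and terms with
  density \<open>(1 - m)\<^sup>k m\<close>. The latter are \<open>k\<close>-fold differences of the averaged transform,
  and their bounds \<open>2\<^sup>k B\<close> add up to at most \<open>2\<^sup>N B\<close>.
\<close>

lemma norm_fourier_transform_le_averages:
  assumes \<delta>: "\<delta> > 0" and "B \<ge> 0" and "R \<ge> 0" and R: "AE x in \<mu>. norm x \<le> R"
    and avg: "\<And>w. norm (w - z) \<le> real N * \<delta> \<Longrightarrow>
       norm (LINT u|unif_ball \<delta>. fourier_transform \<mu> (w + u)) \<le> B"
  shows "norm (fourier_transform \<mu> z)
     \<le> (2 * pi * \<delta> * R) ^ N * measure \<mu> (space \<mu>) + 2 ^ N * B"
proof -
  let ?m = "fourier_transform (unif_ball \<delta> :: 'a measure)"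
  have m: "bounded_borel ?m" by (rule bounded_borel_unif_ball_transform[OF \<delta>])
  have q: "bounded_borel (\<lambda>x. (1 - ?m x) ^ k)" for k
    by (intro bounded_borel_power bounded_borel_diff bounded_borel_const m)
  have avg': "norm (weighted_fourier \<mu> ?m w) \<le> B" if "norm (w - z) \<le> real N * \<delta>" for w
    using avg[OF that] ball_average_weighted_fourier[OF \<delta> bounded_borel_const[of 1], of w]
    by (simp add: fourier_transform_eq_weighted[of \<mu>])
  have tele: "norm (weighted_fourier \<mu> (\<lambda>_. 1) z)
      \<le> norm (weighted_fourier \<mu> (\<lambda>x. (1 - ?m x) ^ k) z) + (\<Sum>j<k. 2 ^ j * B)" if "k \<le> N" for k
    using that
  proof (induction k)
    case 0
    then show ?case by simp
  next
    case (Suc k)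
    have "norm (weighted_fourier \<mu> (\<lambda>x. (1 - ?m x) ^ k * ?m x) z) \<le> 2 ^ k * B"
    proof (rule weighted_fourier_complement_power_le[OF \<delta> m \<open>B \<ge> 0\<close>])
      fix w :: 'a assume "norm (w - z) \<le> real k * \<delta>"
      moreover have "real k * \<delta> \<le> real N * \<delta>" using \<delta> Suc.prems by (intro mult_right_mono) auto
      ultimately show "norm (weighted_fourier \<mu> ?m w) \<le> B" by (intro avg') linarith
    qed
    moreover have "weighted_fourier \<mu> (\<lambda>x. (1 - ?m x) ^ Suc k) z =
        weighted_fourier \<mu> (\<lambda>x. (1 - ?m x) ^ k) z - weighted_fourier \<mu> (\<lambda>x. (1 - ?m x) ^ k * ?m x) z"
      using weighted_fourier_diff[OF q[of k] bounded_borel_mult[OF q[of k] m], of z]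
      by (simp add: algebra_simps)
    ultimately show ?case
      using Suc norm_triangle_sub[of "weighted_fourier \<mu> (\<lambda>x. (1 - ?m x) ^ k) z" "weighted_fourier \<mu> (\<lambda>x. (1 - ?m x) ^ Suc k) z"]
      by simp
  qed
  have "norm (weighted_fourier \<mu> (\<lambda>x. (1 - ?m x) ^ N) z) \<le> (2 * pi * \<delta> * R) ^ N * measure \<mu> (space \<mu>)"
    unfolding weighted_fourier_def
  proof (rule finite_measure_norm_integral_le[OF finite_mu])
    show "AE x in \<mu>. norm ((1 - ?m x) ^ N * wave z x) \<le> (2 * pi * \<delta> * R) ^ N"
      using R
    proof eventually_elim
      case (elim x)
      have "norm (1 - ?m x) \<le> 2 * pi * \<delta> * norm x" by (rule one_minus_unif_ball_transform_le[OF \<delta>])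
      also have "\<dots> \<le> (2 * pi * \<delta> * R)" 
        using elim \<delta> by (intro mult_left_mono) auto
      finally show ?case by (simp add: norm_mult norm_power power_mono)
    qed
  qed (use \<delta> \<open>R \<ge> 0\<close> in simp)
  moreover have "(\<Sum>j<N. 2 ^ j * B) \<le> 2 ^ N * B"
  proof -
    have "(\<Sum>j<N. (2::real) ^ j) \<le> 2 ^ N" by (induction N) auto
    then show ?thesis using \<open>B \<ge> 0\<close> by (simp flip: sum_distrib_right add: mult_right_mono)
  qed
  ultimately show ?thesis using tele[of N] by (simp add: fourier_transform_eq_weighted)
qed

end


section \<open>Decay of averages from a weighted integral bound\<close>

lemma nn_integral_unif_ball_translate_le:
  fixes h :: "'a::euclidean_space \<Rightarrow> ennreal"
  assumes [measurable]: "h \<in> borel_measurable borel"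
  shows "(\<integral>\<^sup>+u. h (w + u) \<partial>unif_ball \<delta>) \<le> (\<integral>\<^sup>+x. h x \<partial>lborel) / emeasure lborel (ball (0::'a) \<delta>)"
proof -
  have "(\<integral>\<^sup>+u. h (w + u) \<partial>unif_ball \<delta>)
      = (\<integral>\<^sup>+u. h (w + u) * indicator (ball 0 \<delta>) u \<partial>lborel) / emeasure lborel (ball (0::'a) \<delta>)"
    unfolding unif_ball_def by (rule nn_integral_uniform_measure) auto
  also have "\<dots> \<le> (\<integral>\<^sup>+u. h (w + u) \<partial>lborel) / emeasure lborel (ball (0::'a) \<delta>)"
    by (intro divide_right_mono_ennreal nn_integral_mono) (auto split: split_indicator)
  also have "(\<integral>\<^sup>+u. h (w + u) \<partial>lborel) = (\<integral>\<^sup>+x. h x \<partial>distr lborel borel ((+) w))"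
    by (subst nn_integral_distr) auto
  finally show ?thesis by (simp add: lborel_distr_plus)
qed

text \<open>
  In place of Jensen's inequality: for every \<open>L > 0\<close> one has
  \<open>y \<le> L + L powr (1 - p) * y powr p\<close>, since either \<open>y \<le> L\<close> or
  \<open>y powr (1 - p) \<le> L powr (1 - p)\<close>. On the ball around \<open>w\<close> the weight is at least
  \<open>(|w| / 2) powr b\<close>, and \<open>L = |w| powr (- b / p)\<close> balances the two terms, because then
  \<open>L powr (1 - p) * |w| powr (- b) = L\<close>.
\<close>

lemma ball_average_decay:
  fixes f :: "'a::euclidean_space \<Rightarrow> complex"
  assumes [measurable]: "f \<in> borel_measurable borel"
    and \<delta>: "\<delta> > 0" and p: "p \<ge> 1" and b: "b \<ge> 0"
    and fin: "(\<integral>\<^sup>+x. ennreal (norm (f x) powr p * norm x powr b) \<partial>lborel) < \<infinity>"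
  obtains C where "C \<ge> 0" and
    "\<And>w. norm w \<ge> 2 * \<delta> \<Longrightarrow> norm (LINT u|unif_ball \<delta>. f (w + u)) \<le> C * norm w powr (- (b / p))"
proof
  define h where "h x = norm (f x) powr p * norm x powr b" for x
  have h0: "h x \<ge> 0" for x by (simp add: h_def)
  have [measurable]: "h \<in> borel_measurable borel" unfolding h_def[abs_def] by measurable
  define V where "V = measure lborel (ball (0::'a) \<delta>)"
  have V: "V > 0" unfolding V_def by (rule content_ball_pos[OF \<delta>])
  have emV: "emeasure lborel (ball (0::'a) \<delta>) = ennreal V"
    unfolding V_def using emeasure_lborel_ball_finite[of "0::'a" \<delta>]
    by (intro emeasure_eq_ennreal_measure) auto
  define E where "E = enn2real (\<integral>\<^sup>+x. ennreal (h x) \<partial>lborel)"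
  have E: "(\<integral>\<^sup>+x. ennreal (h x) \<partial>lborel) = ennreal E" "E \<ge> 0"
    using fin by (auto simp: E_def h_def)
  define C where "C = 1 + 2 powr b * (E / V)"
  show C: "C \<ge> 0" using E V by (simp add: C_def)
  fix w :: 'a assume w: "norm w \<ge> 2 * \<delta>"
  define L where "L = norm w powr (- (b / p))"
  have w0: "norm w > 0" using w \<delta> by linarith
  have L: "L > 0" using w0 by (simp add: L_def)
  have "- (b / p) * (1 - p) = - (b / p) + b" using p by (simp add: field_simps)
  then have "L powr (1 - p) = L * norm w powr b" by (simp only: L_def powr_powr powr_add)
  also have "norm w powr b = 2 powr b * (norm w / 2) powr b" by (simp add: powr_divide)
  finally have Lp: "L powr (1 - p) = L * 2 powr b * (norm w / 2) powr b" by simp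
  have pw: "norm (f (w + u)) \<le> L + L * 2 powr b * h (w + u)" if u: "norm u < \<delta>" for u
  proof (cases "norm (f (w + u)) \<le> L")
    case True
    then show ?thesis using L h0[of "w + u"] by (simp add: add_increasing2)
  next
    case False
    let ?y = "norm (f (w + u))"
    have y: "?y > L" using False by simp
    have "norm w \<le> norm (w + u) + norm u"
      using norm_triangle_ineq4[of "w + u" u] by simp
    with w u have half: "norm w / 2 \<le> norm (w + u)" by linarith
    have "?y = ?y powr (1 - p) * ?y powr p"
      using y L by (simp flip: powr_add)
    also have "\<dots> \<le> L powr (1 - p) * ?y powr p"
      using y L p by (intro mult_right_mono powr_mono2') auto
    also have "L powr (1 - p) = L * 2 powr b * (norm w / 2) powr b" by (rule Lp)
    also have "\<dots> * ?y powr p \<le> L * 2 powr b * norm (w + u) powr b * ?y powr p"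
      using half w0 b L by (intro mult_right_mono mult_left_mono powr_mono2) auto
    also have "\<dots> = L * 2 powr b * h (w + u)" by (simp add: h_def)
    finally show ?thesis using L by linarith
  qed
  show "norm (LINT u|unif_ball \<delta>. f (w + u)) \<le> C * norm w powr (- (b / p))"
  proof (cases "integrable (unif_ball \<delta>) (\<lambda>u. f (w + u))")
    case False
    then show ?thesis using C by (simp add: not_integrable_integral_eq)
  next
    case True
    have "ennreal (norm (LINT u|unif_ball \<delta>. f (w + u))) \<le> (\<integral>\<^sup>+u. norm (f (w + u)) \<partial>unif_ball \<delta>)"
      by (rule integral_norm_bound_ennreal[OF True])
    also have "\<dots> \<le> (\<integral>\<^sup>+u. ennreal L + ennreal (L * 2 powr b) * ennreal (h (w + u)) \<partial>unif_ball \<delta>)"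
    proof (rule nn_integral_mono_AE)
      show "AE u in unif_ball \<delta>. ennreal (norm (f (w + u)))
          \<le> ennreal L + ennreal (L * 2 powr b) * ennreal (h (w + u))"
        using unif_ball_AE[of \<delta>]
      proof eventually_elim
        case (elim u)
        show ?case using pw[OF elim] L h0[of "w + u"]
          by (simp flip: ennreal_plus ennreal_mult)
      qed
    qed
    also have "\<dots> = ennreal L + ennreal (L * 2 powr b) * (\<integral>\<^sup>+u. ennreal (h (w + u)) \<partial>unif_ball \<delta>)"
      using unif_ball_mass[OF \<delta>, where ?'a='a] by (simp add: nn_integral_add nn_integral_cmult)
    also have "\<dots> \<le> ennreal L + ennreal (L * 2 powr b) * ennreal (E / V)"
      using nn_integral_unif_ball_translate_le[of "\<lambda>x. ennreal (h x)" \<delta> w] E V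
      by (intro add_left_mono mult_left_mono) (auto simp: emV divide_ennreal)
    also have "\<dots> = ennreal (C * L)"
      using L E V by (simp add: C_def algebra_simps flip: ennreal_plus ennreal_mult)
    finally show ?thesis using C L unfolding L_def[symmetric] by simp
  qed
qed

section \<open>Pointwise decay of the Fourier transform\<close>

lemma eventually_log_le_linear:
  fixes \<kappa> \<delta> :: real
  shows "eventually (\<lambda>x. (\<kappa> * log 2 x + 1) * \<delta> \<le> x / 2) at_top"
proof -
  have "((\<lambda>x::real. (\<kappa> / ln 2 * (ln x / x) + inverse x) * \<delta>) \<longlongrightarrow> (\<kappa> / ln 2 * 0 + 0) * \<delta>) at_top"
    by (intro tendsto_intros ln_x_over_x_tendsto_0 tendsto_inverse_0_at_top filterlim_ident)
  then have "eventually (\<lambda>x::real. (\<kappa> / ln 2 * (ln x / x) + inverse x) * \<delta> < 1 / 2) at_top"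
    by (rule order_tendstoD) simp
  with eventually_gt_at_top[of 0] show ?thesis
    by eventually_elim (simp add: log_def field_simps)
qed

text \<open>
  The loss \<open>\<kappa> = b / p - r\<close> is fixed first. Then \<open>\<eta> = 2 powr (- r / \<kappa>)\<close> is chosen so that
  \<open>\<eta>\<^sup>N \<le> |z| powr (- r)\<close> as soon as \<open>N \<ge> \<kappa> log\<^sub>2 |z|\<close>, while rounding \<open>N\<close> up
  keeps \<open>2\<^sup>N \<le> 2 |z| powr \<kappa>\<close>. The centres of the averages stay within
  \<open>N \<delta> = O(log |z|)\<close> of \<open>z\<close>, hence have norm at least \<open>|z| / 2\<close> once \<open>|z|\<close> is
  large; for the other \<open>z\<close> the trivial bound by the total mass suffices.
\<close>

lemma fourier_transform_decay:
  fixes \<mu> :: "'a::euclidean_space measure"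
  assumes sets_mu: "sets \<mu> = sets borel" and finite_mu: "finite_measure \<mu>"
    and R: "R \<ge> 0" "AE x in \<mu>. norm x \<le> R"
    and p: "p \<ge> 1" and b: "b \<ge> 0"
    and fin: "(\<integral>\<^sup>+x. ennreal (norm (fourier_transform \<mu> x) powr p * norm x powr b) \<partial>lborel) < \<infinity>"
    and r: "0 \<le> r" "r < b / p"
  shows "\<exists>c>0. \<forall>z. z \<noteq> 0 \<longrightarrow> norm (fourier_transform \<mu> z) \<le> c * norm z powr (- r)"
proof -
  define a \<kappa> where "a = b / p" and "\<kappa> = a - r"
  have \<kappa>: "\<kappa> > 0" using r by (simp add: \<kappa>_def a_def)
  have a: "a \<ge> 0" using b p by (simp add: a_def)
  define \<eta> :: real where "\<eta> = 2 powr (- (r / \<kappa>))"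
  define \<delta> where "\<delta> = \<eta> / (2 * pi * (R + 1))"
  have \<eta>: "\<eta> > 0" by (simp add: \<eta>_def)
  have \<delta>: "\<delta> > 0" using \<eta> R by (simp add: \<delta>_def)
  have "2 * pi * \<delta> * R = \<eta> * (R / (R + 1))" using R by (simp add: \<delta>_def)
  also have "\<dots> \<le> \<eta> * 1" using R \<eta> by (intro mult_left_mono) auto
  finally have \<delta>R: "2 * pi * \<delta> * R \<le> \<eta>" by simp
  have meas: "fourier_transform \<mu> \<in> borel_measurable borel"
    unfolding fourier_transform_eq_weighted
    by (rule weighted_fourier_measurable[OF sets_mu finite_mu bounded_borel_const])
  obtain C where C: "C \<ge> 0"
    and avg: "\<And>w. norm w \<ge> 2 * \<delta> \<Longrightarrow>
      norm (LINT u|unif_ball \<delta>. fourier_transform \<mu> (w + u)) \<le> C * norm w powr (- a)"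
    unfolding a_def using ball_average_decay[OF meas \<delta> p b fin] by blast
  define M where "M = measure \<mu> (space \<mu>)"
  have M: "M \<ge> 0" by (simp add: M_def)
  have triv: "norm (fourier_transform \<mu> z) \<le> M" for z
    using finite_measure_norm_integral_le[OF finite_mu, of "wave z" 1]
    by (simp add: fourier_transform_eq_wave M_def)
  have "eventually (\<lambda>x. (\<kappa> * log 2 x + 1) * \<delta> \<le> x / 2 \<and> x \<ge> max 1 (4 * \<delta>)) at_top"
    by (intro eventually_conj eventually_log_le_linear eventually_ge_at_top)
  then obtain X where X: "\<And>x. x \<ge> X \<Longrightarrow> (\<kappa> * log 2 x + 1) * \<delta> \<le> x / 2 \<and> x \<ge> max 1 (4 * \<delta>)"
    unfolding eventually_at_top_linorder by blast
  \<comment> \<open>The middle term carries \<open>2\<^sup>N \<le> 2 |z| powr \<kappa>\<close> and \<open>(|z| / 2) powr (- a)\<close>, the third the range \<open>|z| \<le> X\<close>.\<close>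
  define c where "c = M + 2 * 2 powr a * C + M * X powr r + 1"
  have large: "norm (fourier_transform \<mu> z) \<le> (M + 2 * 2 powr a * C) * norm z powr (- r)"
    if z: "norm z \<ge> X" for z
  proof -
    let ?x = "norm z"
    define N where "N = nat \<lceil>\<kappa> * log 2 ?x\<rceil>"
    have x: "?x \<ge> 1" "?x \<ge> 4 * \<delta>" "(\<kappa> * log 2 ?x + 1) * \<delta> \<le> ?x / 2" using X[OF z] by auto
    have "\<kappa> * log 2 ?x \<ge> 0" using \<kappa> x(1) by (intro mult_nonneg_nonneg zero_le_log_cancel_iff[THEN iffD2]) auto
    then have N: "\<kappa> * log 2 ?x \<le> real N" "real N \<le> \<kappa> * log 2 ?x + 1"
      unfolding N_def by linarith+
    define B where "B = C * (?x / 2) powr (- a)"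
    have B: "B \<ge> 0" using C by (simp add: B_def)
    have "norm (fourier_transform \<mu> z)
        \<le> (2 * pi * \<delta> * R) ^ N * M + 2 ^ N * B"
      unfolding M_def
    proof (rule norm_fourier_transform_le_averages[OF sets_mu finite_mu \<delta> B R])
      fix w assume w: "norm (w - z) \<le> real N * \<delta>"
      have "real N * \<delta> \<le> (\<kappa> * log 2 ?x + 1) * \<delta>" using N \<delta> by (intro mult_right_mono) auto
      with w x have "norm (w - z) \<le> ?x / 2" by linarith
      then have half: "?x / 2 \<le> norm w"
        using norm_triangle_ineq3[of w z] by linarith
      with x have "norm (LINT u|unif_ball \<delta>. fourier_transform \<mu> (w + u)) \<le> C * norm w powr (- a)"
        by (intro avg) linarith
      also have "\<dots> \<le> B"
        unfolding B_def using half x C a by (intro mult_left_mono powr_mono2') auto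
      finally show "norm (LINT u|unif_ball \<delta>. fourier_transform \<mu> (w + u)) \<le> B" .
    qed
    also have "\<dots> \<le> ?x powr (- r) * M + (2 * ?x powr \<kappa>) * B"
    proof (intro add_mono mult_right_mono)
      have "(2 * pi * \<delta> * R) ^ N \<le> \<eta> ^ N" using \<delta>R \<delta> R by (intro power_mono) auto
      also have "\<dots> = 2 powr (- (r / \<kappa>) * real N)"
        using \<eta> by (simp add: \<eta>_def powr_powr flip: powr_realpow)
      also have "\<dots> \<le> 2 powr (- (r / \<kappa>) * (\<kappa> * log 2 ?x))"
        using N r \<kappa> by (intro powr_mono mult_left_mono_neg) auto
      also have "\<dots> = (2 powr log 2 ?x) powr (- r)"
        using \<kappa> by (simp add: powr_powr mult_ac)
      also have "\<dots> = ?x powr (- r)" using x by (subst powr_log_cancel) auto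
      finally show "(2 * pi * \<delta> * R) ^ N \<le> ?x powr (- r)" .
      have "(2::real) ^ N = 2 powr real N" by (simp add: powr_realpow)
      also have "\<dots> \<le> 2 powr (\<kappa> * log 2 ?x + 1)" using N by (intro powr_mono) auto
      also have "\<dots> = 2 * (2 powr log 2 ?x) powr \<kappa>" by (simp add: powr_add powr_powr mult_ac)
      also have "\<dots> = 2 * ?x powr \<kappa>" using x by (subst powr_log_cancel) auto
      finally show "(2::real) ^ N \<le> 2 * ?x powr \<kappa>" .
    qed (use B M in simp_all)
    also have "(?x / 2) powr (- a) = 2 powr a * ?x powr (- a)"
      using x by (simp add: powr_divide powr_minus field_simps)
    then have "(2 * ?x powr \<kappa>) * B = 2 * 2 powr a * C * (?x powr \<kappa> * ?x powr (- a))"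
      by (simp add: B_def)
    also have "?x powr \<kappa> * ?x powr (- a) = ?x powr (- r)"
      by (simp add: \<kappa>_def flip: powr_add)
    finally show ?thesis by (simp add: algebra_simps)
  qed
  have small: "norm (fourier_transform \<mu> z) \<le> M * X powr r * norm z powr (- r)"
    if z: "z \<noteq> 0" "norm z \<le> X" for z
  proof -
    have "1 = norm z powr r * norm z powr (- r)" using z by (simp flip: powr_add)
    also have "\<dots> \<le> X powr r * norm z powr (- r)"
      using z r by (intro mult_right_mono powr_mono2) auto
    finally have "M * 1 \<le> M * (X powr r * norm z powr (- r))" using M by (intro mult_left_mono) auto
    with triv[of z] show ?thesis by (simp add: mult_ac)
  qed
  show ?thesis
  proof (intro exI[of _ c] conjI allI impI)
    show "c > 0" using M C by (simp add: c_def add_nonneg_pos)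
    fix z :: 'a assume z: "z \<noteq> 0"
    have le: "M + 2 * 2 powr a * C \<le> c" "M * X powr r \<le> c"
      using M C by (auto simp: c_def)
    show "norm (fourier_transform \<mu> z) \<le> c * norm z powr (- r)"
    proof (cases "norm z \<ge> X")
      case True
      show ?thesis by (rule order_trans[OF large[OF True]]) (intro mult_right_mono le, simp)
    next
      case False
      show ?thesis by (rule order_trans[OF small[OF z]]) (use False in simp, intro mult_right_mono le, simp)
    qed
  qed
qed

section \<open>The Fourier spectrum and the Fourier dimension\<close>

text \<open>
  The complement of the support is a union of open null sets; by Lindelof's theorem
  countably many of them suffice.
\<close>

lemma AE_in_msupport:
  fixes \<mu> :: "'a::second_countable_topology measure"
  assumes "sets \<mu> = sets borel"
  shows "AE x in \<mu>. x \<in> msupport \<mu>"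
proof -
  let ?\<F> = "{U. open U \<and> emeasure \<mu> U = 0}"
  obtain \<F>' where F: "\<F>' \<subseteq> ?\<F>" "countable \<F>'" "\<Union>\<F>' = \<Union>?\<F>"
    using Lindelof[of ?\<F>] by auto
  have "(\<Union>U\<in>\<F>'. U) \<in> null_sets \<mu>"
    using F(1) assms by (intro null_sets_UN'[OF F(2)]) (auto simp: null_sets_def)
  moreover have "{x \<in> space \<mu>. \<not> x \<in> msupport \<mu>} \<subseteq> (\<Union>U\<in>\<F>'. U)"
    using F(3) by (auto simp: msupport_def not_gr_zero) 
  ultimately show ?thesis by (rule AE_I')
qed

lemma ennreal_powr_finite_iff: "ennreal_powr x a < \<infinity> \<longleftrightarrow> x < \<infinity>"
  by (auto simp: ennreal_powr_def less_top)

lemma le_fourier_dim: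
  assumes "0 \<le> s"
    and "\<exists>c>0. \<forall>z. z \<noteq> 0 \<longrightarrow> norm (fourier_transform \<mu> z) \<le> c * norm z powr (- s / 2)"
  shows "ennreal s \<le> fourier_dim \<mu>"
  unfolding fourier_dim_def using assms by (intro Sup_upper imageI CollectI conjI)

lemma fourier_decay_of_energy_zero:
  assumes "fourier_energy s 0 \<mu> < \<infinity>"
  shows "\<exists>c>0. \<forall>z. z \<noteq> 0 \<longrightarrow> norm (fourier_transform \<mu> z) \<le> c * norm z powr (- s / 2)"
proof -
  define K where "K = enn2real (fourier_energy s 0 \<mu>)"
  have K: "fourier_energy s 0 \<mu> = ennreal K" "K \<ge> 0" using assms by (auto simp: K_def)
  \<comment> \<open>The constant has to be positive, and \<open>K\<close> may be \<open>0\<close>.\<close>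
  have "norm (fourier_transform \<mu> z) \<le> (sqrt K + 1) * norm z powr (- s / 2)" if z: "z \<noteq> 0" for z
  proof -
    have "ennreal ((norm (fourier_transform \<mu> z))\<^sup>2 * (if s = 0 then 1 else norm z powr s)) \<le> ennreal K"
      unfolding K(1)[symmetric] fourier_energy_def by (auto intro: SUP_upper)
    then have "(norm (fourier_transform \<mu> z))\<^sup>2 * norm z powr s \<le> K"
      using K z by (auto split: if_splits)
    also have "norm z powr s = (norm z powr (s / 2))\<^sup>2"
      using z by (simp add: power2_eq_square flip: powr_add)
    finally have "(norm (fourier_transform \<mu> z) * norm z powr (s / 2))\<^sup>2 \<le> K"
      by (simp add: power_mult_distrib)
    then have "norm (fourier_transform \<mu> z) * norm z powr (s / 2) \<le> sqrt K"
      by (rule real_le_rsqrt)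
    then have "norm (fourier_transform \<mu> z) * norm z powr (s / 2) \<le> sqrt K + 1"
      by simp
    then show ?thesis using z by (simp add: powr_minus field_simps)
  qed
  moreover have "sqrt K + 1 > 0" using K by (simp add: add_nonneg_pos)
  ultimately show ?thesis by blast
qed

theorem proposition4p2:
  fixes \<mu> :: "'a::euclidean_space measure" and \<theta> :: real
  assumes "sets \<mu> = sets borel"
    and "finite_measure \<mu>"
    and "compact (msupport \<mu>)"
    and "0 \<le> \<theta>" and "\<theta> \<le> 1"
  shows "fourier_spectrum \<theta> \<mu> \<le> fourier_dim \<mu> + ennreal (real DIM('a) * \<theta>)"
  unfolding fourier_spectrum_def
proof (rule Sup_least)
  fix y assume "y \<in> ennreal ` {s. 0 \<le> s \<and> fourier_energy s \<theta> \<mu> < \<infinity>}"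
  then obtain s where y: "y = ennreal s" and s: "0 \<le> s" "fourier_energy s \<theta> \<mu> < \<infinity>" by auto
  let ?d = "real DIM('a)"
  have "ennreal s \<le> fourier_dim \<mu> + ennreal (?d * \<theta>)"
  proof (cases "\<theta> = 0")
    case True
    then show ?thesis
      using le_fourier_dim[OF s(1) fourier_decay_of_energy_zero] s(2) by simp
  next
    case False
    then have \<theta>: "\<theta> > 0" using assms by simp
    obtain R where R: "\<And>x. x \<in> msupport \<mu> \<Longrightarrow> norm x \<le> R"
      using compact_imp_bounded[OF assms(3)] by (auto simp: bounded_iff)
    have AE: "AE x in \<mu>. norm x \<le> max 0 R"
      using AE_in_msupport[OF assms(1)] by eventually_elim (use R in fastforce)
    have fin: "(\<integral>\<^sup>+x. ennreal (norm (fourier_transform \<mu> x) powr (2 / \<theta>)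
        * norm x powr (s / \<theta> - ?d)) \<partial>lborel) < \<infinity>"
      using s(2) False unfolding fourier_energy_def by (simp only: if_False ennreal_powr_finite_iff)
    \<comment> \<open>If \<open>s \<le> d \<theta>\<close>, the left-hand side is \<open>0\<close> and there is no \<open>t\<close> below it.\<close>
    have "ennreal (s - ?d * \<theta>) \<le> fourier_dim \<mu>"
    proof (rule dense_le)
      fix y assume y: "y < ennreal (s - ?d * \<theta>)"
      then obtain t where t: "y = ennreal t" "0 \<le> t" "t < s - ?d * \<theta>"
        by (cases y) (auto simp: ennreal_less_iff)
      have "(s / \<theta> - ?d) / (2 / \<theta>) = (s - ?d * \<theta>) / 2" using \<theta> by (simp add: field_simps)
      then have "t / 2 < (s / \<theta> - ?d) / (2 / \<theta>)" using t by simp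
      moreover have "s / \<theta> - ?d \<ge> 0" using t \<theta> by (simp add: field_simps)
      moreover have "2 / \<theta> \<ge> 1" using \<theta> assms by (simp add: field_simps)
      ultimately have "\<exists>c>0. \<forall>z. z \<noteq> 0 \<longrightarrow> norm (fourier_transform \<mu> z) \<le> c * norm z powr (- (t / 2))"
        using t by (intro fourier_transform_decay[OF assms(1,2) _ AE _ _ fin]) auto
      then show "y \<le> fourier_dim \<mu>" unfolding t using t by (intro le_fourier_dim) auto
    qed
    have "ennreal s \<le> ennreal (max 0 (s - ?d * \<theta>) + ?d * \<theta>)"
      by (rule ennreal_leI) simp
    also have "\<dots> = ennreal (s - ?d * \<theta>) + ennreal (?d * \<theta>)"
      using \<theta> by (cases "s - ?d * \<theta> \<ge> 0") (simp_all add: max_def ennreal_neg flip: ennreal_plus)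
    also have "\<dots> \<le> fourier_dim \<mu> + ennreal (?d * \<theta>)"
      by (rule add_right_mono) fact
    finally show ?thesis .
  qed
  then show "y \<le> fourier_dim \<mu> + ennreal (?d * \<theta>)" by (simp add: y)
qed

end
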